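(* Let $F$ be R. Thompson's group, let $K$ be a field and let $R=K[F]$ be the group ring of $F$ over $K$. Then for any element $b\in R$, the equation $(1-x_0)u=bv$ has a non-zero solution $(u,v)$ in $R$, that is, there exist $u,v\in R$ with $(1-x_0)u=bv$ and with $u\neq0$ or $v\neq0$.
   Context: R. Thompson's group $F$ is the group given by the presentation $\langle x_0,x_1,x_2,\ldots \mid x_jx_i=x_ix_{j+1}\ (0\le i<j)\rangle$. *)

theory Defs
  imports "HOL-Library.Poly_Mapping"
begin

text \<open>
  Groups given by generators and relations. A letter \<open>(e, a)\<close> stands for the generator \<open>a\<close>
  if \<open>e\<close> is true and for its formal inverse otherwise; \<open>pres_eq R\<close> is the least congruence
  on words that contains the free cancellations and all pairs in \<open>R\<close>.
\<close>

type_synonym 'a word = "(bool \<times> 'a) list"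

inductive pres_eq :: "('a word \<times> 'a word) set \<Rightarrow> 'a word \<Rightarrow> 'a word \<Rightarrow> bool" for R where
  refl: "pres_eq R w w"
| sym: "pres_eq R v w \<Longrightarrow> pres_eq R w v"
| trans: "pres_eq R u v \<Longrightarrow> pres_eq R v w \<Longrightarrow> pres_eq R u w"
| append: "pres_eq R v v' \<Longrightarrow> pres_eq R w w' \<Longrightarrow> pres_eq R (v @ w) (v' @ w')"
| cancel: "pres_eq R [(e, a), (\<not> e, a)] []"
| rel: "(v, w) \<in> R \<Longrightarrow> pres_eq R v w"

definition inv_word :: "'a word \<Rightarrow> 'a word" where
  "inv_word w = rev (map (\<lambda>(e, a). (\<not> e, a)) w)"

lemma equivp_pres_eq: "equivp (pres_eq R)"
  by (rule equivpI) (auto intro!: reflpI sympI transpI intro: pres_eq.refl pres_eq.sym pres_eq.trans)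

lemma inv_word_right: "pres_eq R (w @ inv_word w) []"
proof (induction w)
  case Nil
  show ?case by (simp add: inv_word_def pres_eq.refl)
next
  case (Cons l w)
  obtain e a where l: "l = (e, a)" by (cases l)
  have "pres_eq R ([l] @ ((w @ inv_word w) @ [(\<not> e, a)])) ([l] @ ([] @ [(\<not> e, a)]))"
    by (intro pres_eq.append pres_eq.refl Cons.IH)
  moreover have "pres_eq R ([l] @ ([] @ [(\<not> e, a)])) []"
    by (simp add: l pres_eq.cancel)
  ultimately have "pres_eq R ([l] @ ((w @ inv_word w) @ [(\<not> e, a)])) []"
    by (rule pres_eq.trans)
  then show ?case by (simp add: l inv_word_def)
qed

lemma inv_word_inv_word [simp]: "inv_word (inv_word w) = w"
  by (simp add: inv_word_def rev_map comp_def case_prod_beta)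

lemma inv_word_left: "pres_eq R (inv_word w @ w) []"
  using inv_word_right[of R "inv_word w"] by simp

lemma inv_word_cong:
  assumes "pres_eq R v w"
  shows "pres_eq R (inv_word v) (inv_word w)"
proof -
  have "pres_eq R (inv_word v @ []) (inv_word v @ (w @ inv_word w))"
    by (intro pres_eq.append pres_eq.refl pres_eq.sym[OF inv_word_right])
  moreover have "pres_eq R (inv_word v @ (w @ inv_word w)) (inv_word v @ (v @ inv_word w))"
    by (intro pres_eq.append pres_eq.refl pres_eq.sym[OF assms])
  moreover have "pres_eq R ((inv_word v @ v) @ inv_word w) ([] @ inv_word w)"
    by (intro pres_eq.append pres_eq.refl inv_word_left)
  ultimately show ?thesis
    by (simp, meson pres_eq.trans)
qed

definition thompson_rels :: "(nat word \<times> nat word) set" where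
  "thompson_rels =
    {([(True, j), (True, i)], [(True, i), (True, j + 1)]) | i j. i < j}"

quotient_type thompson_F = "nat word" / "pres_eq thompson_rels"
  by (rule equivp_pres_eq)

text \<open>
  The group law of \<open>F\<close> is written additively although \<open>F\<close> is not commutative, because
  the convolution product on \<^typ>\<open>'g \<Rightarrow>\<^sub>0 'k\<close> is set up for additive monoids \<open>'g\<close>
  (class \<^class>\<open>monoid_add\<close>, not necessarily commutative). Thus \<open>g + h\<close> is the product \<open>gh\<close>
  in \<open>F\<close>, and \<open>0\<close> is the identity.
\<close>

instantiation thompson_F :: group_add
begin

lift_definition zero_thompson_F :: thompson_F is "[]" .

lift_definition plus_thompson_F :: "thompson_F \<Rightarrow> thompson_F \<Rightarrow> thompson_F" is "(@)"
  by (rule pres_eq.append)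

lift_definition uminus_thompson_F :: "thompson_F \<Rightarrow> thompson_F" is inv_word
  by (rule inv_word_cong)

definition minus_thompson_F :: "thompson_F \<Rightarrow> thompson_F \<Rightarrow> thompson_F" where
  "minus_thompson_F g h = g + (- h)"

instance
proof
  fix a b c :: thompson_F
  show "a + b + c = a + (b + c)" by transfer (simp add: pres_eq.refl)
  show "0 + a = a" by transfer (simp add: pres_eq.refl)
  show "a + 0 = a" by transfer (simp add: pres_eq.refl)
  show "- a + a = 0" by transfer (rule inv_word_left)
  show "a + - b = a - b" by (simp add: minus_thompson_F_def)
qed

end

lift_definition thompson_gen :: "nat \<Rightarrow> thompson_F" is "\<lambda>i. [(True, i)]" .

lemma thompson_gen_relation:
  "i < j \<Longrightarrow> thompson_gen j + thompson_gen i = thompson_gen i + thompson_gen (j + 1)"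
  by transfer (auto simp: thompson_rels_def intro!: pres_eq.rel)

type_synonym ('g, 'k) group_ring = "'g \<Rightarrow>\<^sub>0 'k"

definition group_ring_elem :: "'g \<Rightarrow> ('g, 'k::zero_neq_one) group_ring" where
  "group_ring_elem g = Poly_Mapping.single g 1"

lemma group_ring_elem_add:
  "group_ring_elem (g + h) =
    (group_ring_elem g * group_ring_elem h :: ('g::monoid_add, 'k::semiring_1) group_ring)"
  by (simp add: group_ring_elem_def mult_single)

end

theory Submission imports Defs "HOL.Vector_Spaces" begin

text \<open>
  Modulo the right ideal \<open>(1 - x\<^sub>0)R\<close> a left factor \<open>x\<^sub>0\<close> may be dropped, so it suffices to find
  \<open>v \<noteq> 0\<close> such that the residue of \<open>b v\<close> vanishes. After right multiplication by a common
  denominator, every \<open>g\<close> in the support of \<open>b\<close> has the form \<open>x\<^sub>0\<^sup>a w\<close> with \<open>w\<close> a product of at most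
  \<open>d\<close> generators of positive index. As \<open>w x\<^sub>0\<^sup>k = x\<^sub>0\<^sup>k w'\<close>, where \<open>w'\<close> is \<open>w\<close> with all indices raised
  by \<open>k\<close>, the residue of \<open>g x\<^sub>0\<^sup>k z\<close> is \<open>w' z\<close>. Let \<open>z\<close> range over the set \<open>Z\<^sub>n\<close> of
  products of \<open>n\<close> generators with indices \<open>1 \<le> i\<^sub>1 \<le> \<dots> \<le> i\<^sub>n \<le> r + n\<close>, and \<open>k\<close> over \<open>0, \<dots>, N - 1\<close>,
  with \<open>r\<close> large compared to \<open>N\<close>. All residues are supported in \<open>Z\<^sub>n \<union> \<dots> \<union> Z\<^sub>n\<^sub>+\<^sub>d\<close>. Since \<open>Z\<^sub>n\<close> has at
  most \<open>2\<^sup>r 4\<^sup>n\<close> elements, a bound whose growth rate does not depend on \<open>r\<close>, for \<open>N\<close> large in terms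
  of \<open>d\<close> some \<open>n\<close> makes this union smaller than the number of the elements \<open>x\<^sub>0\<^sup>k z\<close>. Hence the
  linear system for \<open>v\<close> has more unknowns than equations.
\<close>

section \<open>Positive words\<close>

abbreviation gen_prod :: "nat list \<Rightarrow> thompson_F" where
  "gen_prod w \<equiv> sum_list (map thompson_gen w)"

lemma gen_add_gen:
  "i < j \<Longrightarrow> thompson_gen j + (thompson_gen i + h) = thompson_gen i + (thompson_gen (Suc j) + h)"
  using thompson_gen_relation[of i j] by (simp flip: add.assoc)

lemma thompson_F_induct [case_names zero gen inv_gen]:
  assumes "P 0"
    and "\<And>i g. P g \<Longrightarrow> P (thompson_gen i + g)"
    and "\<And>i g. P g \<Longrightarrow> P (- thompson_gen i + g)"
  shows "P g"
proof (induction g rule: thompson_F.abs_induct)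
  case (1 w)
  show ?case
  proof (induction w)
    case Nil
    then show ?case using assms(1) by (simp add: zero_thompson_F_def)
  next
    case (Cons l w)
    obtain e i where l: "l = (e, i)" by (cases l)
    have "abs_thompson_F (l # w) = (if e then thompson_gen i else - thompson_gen i) + abs_thompson_F w"
      by (simp add: l thompson_gen.abs_eq uminus_thompson_F.abs_eq plus_thompson_F.abs_eq inv_word_def)
    then show ?case using assms(2,3) Cons by (cases e) auto
  qed
qed

text \<open>The Ore condition for one generator. When \<open>x_i\<close> meets a different letter
  \<open>x_j\<close>, the larger of the two indices rises by one, so \<open>i\<close> varies in the
  induction; an equal letter ends the process.\<close>

lemma gen_common_multiple: "\<exists>c q. gen_prod p + gen_prod c = thompson_gen i + gen_prod q"
proof (induction p arbitrary: i)
  case Nil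
  show ?case by (rule exI[of _ "[i]"], rule exI[of _ "[]"]) simp
next
  case (Cons j p)
  consider "j = i" | "j < i" | "i < j" by linarith
  then show ?case
  proof cases
    case 1
    then show ?thesis by (intro exI[of _ "[]"] exI[of _ p]) simp
  next
    case 2
    obtain c q where "gen_prod p + gen_prod c = thompson_gen (Suc i) + gen_prod q"
      using Cons by blast
    then show ?thesis
      using 2 by (intro exI[of _ c] exI[of _ "j # q"]) (simp add: add.assoc gen_add_gen)
  next
    case 3
    obtain c q where "gen_prod p + gen_prod c = thompson_gen i + gen_prod q"
      using Cons by blast
    then show ?thesis
      using 3 by (intro exI[of _ c] exI[of _ "Suc j # q"]) (simp add: add.assoc gen_add_gen)
  qed
qed

text \<open>An inverse generator on the left is absorbed by enlarging the right factor until the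
  positive product begins with that generator.\<close>

lemma positive_right_multiple: "\<exists>c p. g + gen_prod c = gen_prod p"
proof (induction g rule: thompson_F_induct)
  case zero
  then show ?case by auto
next
  case (gen i g)
  then obtain c p where "g + gen_prod c = gen_prod p" by blast
  then have "thompson_gen i + g + gen_prod c = gen_prod (i # p)" by (simp add: add.assoc)
  then show ?case by blast
next
  case (inv_gen i g)
  then obtain c p where p: "g + gen_prod c = gen_prod p" by blast
  obtain c' q where "gen_prod p + gen_prod c' = thompson_gen i + gen_prod q"
    using gen_common_multiple by blast
  then have "- thompson_gen i + g + gen_prod (c @ c') = gen_prod q"
    by (simp add: add.assoc flip: p)
  then show ?case by blast
qed

lemma common_denominator:
  assumes "finite A"
  shows "\<exists>c. \<forall>g\<in>A. \<exists>p. g + gen_prod c = gen_prod p"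
  using assms
proof (induction A rule: finite_induct)
  case (insert g A)
  then obtain c where c: "\<forall>g\<in>A. \<exists>p. g + gen_prod c = gen_prod p" by blast
  obtain c' p' where p': "g + gen_prod c + gen_prod c' = gen_prod p'"
    using positive_right_multiple by blast
  have "\<exists>p. h + gen_prod (c @ c') = gen_prod p" if h: "h \<in> insert g A" for h
  proof (cases "h = g")
    case True
    then show ?thesis using p' by (auto simp: add.assoc)
  next
    case False
    then obtain p where "h + gen_prod c = gen_prod p" using c h by blast
    then have "h + gen_prod (c @ c') = gen_prod (p @ c')" by (simp flip: add.assoc)
    then show ?thesis by blast
  qed
  then show ?case by blast
qed simp

lemma gen_add_replicate:
  "0 < j \<Longrightarrow> thompson_gen j + (gen_prod (replicate a 0) + h)
    = gen_prod (replicate a 0) + (thompson_gen (j + a) + h)"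
  by (induction a arbitrary: j) (simp_all add: add.assoc gen_add_gen)

lemma gen_prod_add_replicate:
  "0 \<notin> set w \<Longrightarrow> gen_prod w + (gen_prod (replicate k 0) + h)
    = gen_prod (replicate k 0) + (gen_prod (map (\<lambda>i. i + k) w) + h)"
  by (induction w) (simp_all add: add.assoc gen_add_replicate del: map_replicate)

lemma split_leading_gen0:
  "\<exists>a w. 0 \<notin> set w \<and> gen_prod p = gen_prod (replicate a 0) + gen_prod w"
proof (induction p)
  case Nil
  then show ?case by (intro exI[of _ 0] exI[of _ "[]"]) simp
next
  case (Cons j p)
  then obtain a w where w: "0 \<notin> set w" "gen_prod p = gen_prod (replicate a 0) + gen_prod w"
    by blast
  show ?case
  proof (cases "j = 0")
    case True
    then show ?thesis
      using w by (intro exI[of _ "Suc a"] exI[of _ w]) (simp add: add.assoc)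
  next
    case False
    then show ?thesis
      \<comment> \<open>\<open>x_j\<close> crosses \<open>a\<close> copies of \<open>x_0\<close>,
        each raising its index by one.\<close>
      using w by (intro exI[of _ a] exI[of _ "(j + a) # w"]) (simp add: gen_add_replicate del: map_replicate)
  qed
qed

section \<open>Sorted products\<close>

text \<open>The products of \<open>n\<close> generators whose indices weakly increase within \<open>{a..<a + m}\<close>.\<close>

fun sorted_prods :: "nat \<Rightarrow> nat \<Rightarrow> nat \<Rightarrow> thompson_F set" where
  "sorted_prods 0 m a = {0}"
| "sorted_prods (Suc n) 0 a = {}"
| "sorted_prods (Suc n) (Suc m) a =
    (+) (thompson_gen a) ` sorted_prods n (Suc m) a \<union> sorted_prods (Suc n) m (Suc a)"

text \<open>Both recursive calls lower \<open>n + m\<close> by one, so the two bounds add up to the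
  next power of 2.\<close>

lemma sorted_prods_bound: "finite (sorted_prods n m a) \<and> card (sorted_prods n m a) \<le> 2 ^ (n + m)"
proof (induction n m a rule: sorted_prods.induct)
  case (3 n m a)
  have "card (sorted_prods (Suc n) (Suc m) a)
      \<le> card (sorted_prods n (Suc m) a) + card (sorted_prods (Suc n) m (Suc a))"
    using 3 by (auto intro!: card_Un_le[THEN order_trans] add_mono card_image_le)
  then show ?case using 3 by auto
qed auto

lemma sorted_prods_mono: "m \<le> m' \<Longrightarrow> sorted_prods n m a \<subseteq> sorted_prods n m' a"
proof (induction n m a arbitrary: m' rule: sorted_prods.induct)
  case (3 n m a)
  obtain m'' where m': "m' = Suc m''" "m \<le> m''" using 3(3) by (cases m') auto
  then show ?case using 3(1)[of m'] 3(2)[of m''] by auto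
qed auto

lemma gen_in_sorted_prods: "a \<le> k \<Longrightarrow> k < a + m \<Longrightarrow> thompson_gen k \<in> sorted_prods (Suc 0) m a"
proof (induction m arbitrary: a)
  case (Suc m)
  then show ?case using Suc.IH[of "Suc a"] by (cases "k = a") auto
qed simp

text \<open>Insertion into a sorted product: each smaller letter crossed raises the index by one,
  and at most \<open>n\<close> are crossed, so the index stays at most \<open>k + n\<close>.\<close>

lemma gen_add_sorted_prods:
  "g \<in> sorted_prods n m a \<Longrightarrow> a \<le> k \<Longrightarrow> k + n < a + m' \<Longrightarrow> m \<le> m' \<Longrightarrow>
    thompson_gen k + g \<in> sorted_prods (Suc n) m' a"
proof (induction n m a arbitrary: k m' g rule: sorted_prods.induct)
  case (1 m a)
  then show ?case using gen_in_sorted_prods by simp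
next
  case (3 n m a)
  obtain m'' where m': "m' = Suc m''" "m \<le> m''" using 3(6) by (cases m') auto
  show ?case
  proof (cases "k = a")
    case True
    have "g \<in> sorted_prods (Suc n) m' a"
      using 3(3) sorted_prods_mono[OF 3(6)] by blast
    then show ?thesis using True m' by simp
  next
    case False
    then have k: "a < k" using 3(4) by simp
    from 3(3) consider g' where "g = thompson_gen a + g'" "g' \<in> sorted_prods n (Suc m) a"
      | "g \<in> sorted_prods (Suc n) m (Suc a)" by auto
    then show ?thesis
    proof cases
      case 1
      then have "thompson_gen (Suc k) + g' \<in> sorted_prods (Suc n) m' a"
        using 3(1)[of g' "Suc k" m'] 3(4,5,6) by simp
      then show ?thesis using 1 k m' by (simp add: gen_add_gen)
    next
      case 2
      then have "thompson_gen k + g \<in> sorted_prods (Suc (Suc n)) m'' (Suc a)"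
        using 3(2)[of g k m''] 3(5) k m' by simp
      then show ?thesis using m' by simp
    qed
  qed
qed simp

lemma gen_prod_add_sorted_prods:
  assumes "set w \<subseteq> {1..r}" "z \<in> sorted_prods n (r + n) 1"
  shows "gen_prod w + z \<in> sorted_prods (length w + n) (r + (length w + n)) 1"
  using assms(1)
proof (induction w)
  case (Cons k w)
  then have "thompson_gen k + (gen_prod w + z)
      \<in> sorted_prods (Suc (length w + n)) (r + Suc (length w + n)) 1"
    by (intro gen_add_sorted_prods[of _ "length w + n" "r + (length w + n)"]) auto
  then show ?case by (simp add: add.assoc)
qed (use assms(2) in simp)

text \<open>Left multiplication by a power of \<open>x_1\<close> embeds the smaller set into the
  larger one.\<close>

lemma card_sorted_prods_mono:
  assumes "n \<le> n'" "1 \<le> r"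
  shows "card (sorted_prods n (r + n) 1) \<le> card (sorted_prods n' (r + n') 1)"
proof (rule card_inj_on_le)
  let ?w = "replicate (n' - n) 1"
  show "inj_on ((+) (gen_prod ?w)) (sorted_prods n (r + n) 1)" by (simp add: inj_on_def)
  show "(+) (gen_prod ?w) ` sorted_prods n (r + n) 1 \<subseteq> sorted_prods n' (r + n') 1"
    using gen_prod_add_sorted_prods[of ?w r _ n] assms by (auto simp: set_replicate_conv_if)
qed (use sorted_prods_bound in blast)

text \<open>Otherwise the sizes would grow by a factor \<open>2 ^ Suc (2 * d)\<close> every
  \<open>d\<close> steps, against the bound \<open>2 ^ (r + 2 * n)\<close>.\<close>

lemma sorted_prods_slow_growth:
  assumes "1 \<le> r"
  shows "\<exists>n. card (sorted_prods (n + d) (r + (n + d)) 1)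
    < 2 ^ Suc (2 * d) * card (sorted_prods n (r + n) 1)"
proof (rule ccontr)
  define s where "s n = card (sorted_prods n (r + n) 1)" for n
  assume "\<not> ?thesis"
  then have step: "2 ^ Suc (2 * d) * s n \<le> s (n + d)" for n
    by (force simp: s_def not_less)
  have "2 ^ (Suc (2 * d) * k) \<le> s (k * d)" for k
  proof (induction k)
    case 0
    then show ?case by (simp add: s_def)
  next
    case (Suc k)
    have "2 ^ (Suc (2 * d) * Suc k) = 2 ^ Suc (2 * d) * (2::nat) ^ (Suc (2 * d) * k)"
      by (simp add: power_add)
    also have "\<dots> \<le> s (Suc k * d)"
      using Suc step[of "k * d"] by (simp add: add.commute) (meson le_trans mult_le_mono2)
    finally show ?case .
  qed
  \<comment> \<open>After \<open>k\<close> steps the exponents are \<open>(2 * d + 1) * k\<close>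
    and \<open>r + 2 * d * k\<close>, which conflict once \<open>k > r\<close>.\<close>
  from this[of "Suc r"] have "(2::nat) ^ (Suc (2 * d) * Suc r) \<le> 2 ^ (Suc r * d + (r + Suc r * d))"
    using sorted_prods_bound[of "Suc r * d" "r + Suc r * d" 1] unfolding s_def
    by (meson le_trans)
  then have "Suc (2 * d) * Suc r \<le> Suc r * d + (r + Suc r * d)"
    by (simp only: power_increasing_iff)
  then show False by (simp add: algebra_simps)
qed

section \<open>The exponent of the first generator\<close>

text \<open>A homomorphism to the integers that tells the powers of \<open>x_0\<close> apart. It
  respects the relations: as \<open>i < j\<close>, only \<open>x_i\<close> can be
  \<open>x_0\<close>, and it occurs once on each side.\<close>

lift_definition gen0_exponent :: "thompson_F \<Rightarrow> int" is
  "\<lambda>w. \<Sum>(e, i)\<leftarrow>w. if i = 0 then if e then 1 else - 1 else 0"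
proof -
  fix v w :: "nat word"
  assume "pres_eq thompson_rels v w"
  then show "(\<Sum>(e, i)\<leftarrow>v. if i = 0 then if e then 1 else - 1 else 0)
    = (\<Sum>(e, i)\<leftarrow>w. if i = 0 then if e then 1 else - 1 else (0::int))"
    by (induction rule: pres_eq.induct) (auto simp: thompson_rels_def)
qed

lemma gen0_exponent_add [simp]: "gen0_exponent (g + h) = gen0_exponent g + gen0_exponent h"
  by transfer simp

lemma gen0_exponent_zero [simp]: "gen0_exponent 0 = 0"
  by transfer simp

lemma gen0_exponent_gen [simp]: "gen0_exponent (thompson_gen i) = (if i = 0 then 1 else 0)"
  by transfer simp

lemma gen0_exponent_replicate [simp]: "gen0_exponent (gen_prod (replicate k 0)) = int k"
  by (induction k) simp_all

lemma gen0_exponent_sorted_prods: "g \<in> sorted_prods n m a \<Longrightarrow> 0 < a \<Longrightarrow> gen0_exponent g = 0"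
  by (induction n m a arbitrary: g rule: sorted_prods.induct) auto

text \<open>The exponent of \<open>x_0\<close> vanishes on the sorted products, so it recovers
  \<open>k\<close>; cancellation then recovers \<open>z\<close>.\<close>

lemma inj_on_gen0_power_add:
  "inj_on (\<lambda>(k, z). gen_prod (replicate k 0) + z) (A \<times> sorted_prods n m 1)"
proof (intro inj_onI, clarify)
  fix k z l z'
  assume z: "z \<in> sorted_prods n m 1" "z' \<in> sorted_prods n m 1"
    and eq: "gen_prod (replicate k 0) + z = gen_prod (replicate l 0) + z'"
  from arg_cong[OF eq, of gen0_exponent] have "k = l"
    using z by (simp add: gen0_exponent_sorted_prods del: map_replicate)
  with eq show "k = l \<and> z = z'" by simp
qed

section \<open>Linear algebra in the group ring\<close>

text \<open>Scalars act from the right, so by associativity left multiplication by any ring element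
  is linear.\<close>

interpretation group_ring: vector_space
  "\<lambda>(c::'k::field) (x::('g::monoid_add, 'k) group_ring). x * Poly_Mapping.single 0 c"
  by unfold_locales (simp_all add: distrib_left distrib_right single_add mult_single mult.assoc mult.commute)

text \<open>Two equal values of \<open>f\<close> give a relation with coefficients 1 and -1; if
  there are none, the image is too large to be independent.\<close>

lemma (in vector_space) nontrivial_relation:
  assumes "finite T" "card T < card Y" "\<And>y. y \<in> Y \<Longrightarrow> f y \<in> span T"
  shows "\<exists>c. (\<exists>y\<in>Y. c y \<noteq> 0) \<and> (\<Sum>y\<in>Y. c y *s f y) = 0"
proof (cases "inj_on f Y")
  case True
  have fin: "finite Y" using assms(2) by (metis card.infinite not_less_zero)
  have "dependent (f ` Y)"
    using independent_span_bound[of T "f ` Y"] assms True by (auto simp: card_image)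
  then obtain u where u: "\<exists>x\<in>f ` Y. u x \<noteq> 0" "(\<Sum>x\<in>f ` Y. u x *s x) = 0"
    using fin by (auto simp: dependent_finite)
  then show ?thesis using True
    by (intro exI[of _ "u \<circ> f"]) (simp add: sum.reindex)
next
  case False
  have fin: "finite Y" using assms(2) by (metis card.infinite not_less_zero)
  from False obtain y y' where y: "y \<in> Y" "y' \<in> Y" "y \<noteq> y'" "f y = f y'"
    by (auto simp: inj_on_def)
  define c :: "_ \<Rightarrow> 'a" where "c x = (if x = y then 1 else 0) - (if x = y' then 1 else 0)" for x
  have "(\<Sum>x\<in>Y. c x *s f x)
      = (\<Sum>x\<in>Y. if x = y then f x else 0) - (\<Sum>x\<in>Y. if x = y' then f x else 0)"
    unfolding sum_subtractf[symmetric] c_def by (rule sum.cong) (auto simp: scale_left_diff_distrib)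
  then have "(\<Sum>x\<in>Y. c x *s f x) = 0" using y fin by simp
  moreover have "c y \<noteq> 0" using y by (simp add: c_def)
  ultimately show ?thesis using y by blast
qed

text \<open>Iterates \<open>x_0 * s = s - (1 - x_0) * s\<close>.\<close>

lemma drop_gen0_power:
  fixes \<beta> :: "'k::field"
  shows "\<exists>u. Poly_Mapping.single (gen_prod (replicate m 0) + h) \<beta>
    = Poly_Mapping.single h \<beta> + (1 - group_ring_elem (thompson_gen 0)) * u"
proof (induction m)
  case 0
  then show ?case by (intro exI[of _ 0]) simp
next
  case (Suc m)
  then obtain u where u: "Poly_Mapping.single (gen_prod (replicate m 0) + h) \<beta>
    = Poly_Mapping.single h \<beta> + (1 - group_ring_elem (thompson_gen 0)) * u" by blast
  let ?s = "Poly_Mapping.single (gen_prod (replicate m 0) + h) \<beta>"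
  have "Poly_Mapping.single (gen_prod (replicate (Suc m) 0) + h) \<beta>
      = group_ring_elem (thompson_gen 0) * ?s"
    by (simp add: group_ring_elem_def mult_single add.assoc)
  also have "\<dots> = ?s + (1 - group_ring_elem (thompson_gen 0)) * (- ?s)"
    by (simp add: algebra_simps)
  also have "\<dots> = Poly_Mapping.single h \<beta> + (1 - group_ring_elem (thompson_gen 0)) * (u - ?s)"
    by (subst u) (simp add: algebra_simps)
  finally show ?case by blast
qed

lemma poly_mapping_eq_sum_single:
  "(\<Sum>g\<in>Poly_Mapping.keys p. Poly_Mapping.single g (Poly_Mapping.lookup p g)) = p"
  by (rule poly_mapping_eqI)
     (auto simp: lookup_sum lookup_single when_def in_keys_iff)

lemma sum_single_nonzero:
  assumes "finite Y" "inj_on f Y" "y \<in> Y" "c y \<noteq> (0::'k::comm_monoid_add)"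
  shows "(\<Sum>y\<in>Y. Poly_Mapping.single (f y) (c y)) \<noteq> 0"
proof -
  have "Poly_Mapping.lookup (\<Sum>y\<in>Y. Poly_Mapping.single (f y) (c y)) (f y)
      = (\<Sum>x\<in>Y. if x = y then c x else 0)"
    using assms(2,3) by (auto simp: lookup_sum lookup_single when_def inj_on_eq_iff intro!: sum.cong)
  also have "\<dots> = c y" using assms(1,3) by simp
  finally show ?thesis using assms(4) by auto
qed

theorem theorem2:
  fixes b :: "(thompson_F, 'k::field) group_ring"
  shows "\<exists>u v :: (thompson_F, 'k) group_ring.
    (1 - group_ring_elem (thompson_gen 0)) * u = b * v \<and> (u \<noteq> 0 \<or> v \<noteq> 0)"
proof -
  obtain q where q: "\<forall>g\<in>Poly_Mapping.keys b. \<exists>p. g + gen_prod q = gen_prod p"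
    using common_denominator[OF finite_keys] by blast
  have "\<forall>g\<in>Poly_Mapping.keys b. \<exists>a w. 0 \<notin> set w \<and>
      g + gen_prod q = gen_prod (replicate a 0) + gen_prod w"
    using q split_leading_gen0 by metis
  then obtain a w where w: "\<And>g. g \<in> Poly_Mapping.keys b \<Longrightarrow> 0 \<notin> set (w g)"
    "\<And>g. g \<in> Poly_Mapping.keys b \<Longrightarrow>
      g + gen_prod q = gen_prod (replicate (a g) 0) + gen_prod (w g)"
    by metis
  obtain d where d: "\<And>g. g \<in> Poly_Mapping.keys b \<Longrightarrow> length (w g) \<le> d"
    using finite_keys[of b] bdd_above_finite[of "(length \<circ> w) ` Poly_Mapping.keys b"]
    by (auto simp: bdd_above_def)
  obtain m where m: "\<And>g i. g \<in> Poly_Mapping.keys b \<Longrightarrow> i \<in> set (w g) \<Longrightarrow> i \<le> m"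
    using finite_keys[of b] bdd_above_finite[of "\<Union>g\<in>Poly_Mapping.keys b. set (w g)"]
    by (auto simp: bdd_above_def)
  \<comment> \<open>The factor \<open>Suc d\<close> pays for the layers of \<open>T\<close>, the
    power of 2 for the growth from \<open>Z n\<close> to \<open>Z (n + d)\<close>. As
    \<open>N\<close> depends on \<open>d\<close> only, \<open>r\<close> can then be chosen to bound
    all indices shifted by \<open>k < N\<close>.\<close>
  define N where "N = Suc d * 2 ^ Suc (2 * d)"
  define r where "r = m + N"
  define Z where "Z n = sorted_prods n (r + n) 1" for n
  have finZ: "finite (Z n)" for n by (simp add: Z_def sorted_prods_bound)
  have r: "1 \<le> r" by (simp add: r_def N_def Suc_le_eq)
  obtain n where n: "card (Z (n + d)) < 2 ^ Suc (2 * d) * card (Z n)"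
    using sorted_prods_slow_growth[OF r] unfolding Z_def by blast
  define Y where "Y = {..<N} \<times> Z n"
  define T where "T = (\<Union>i\<le>d. Z (n + i))"
  define y where "y = (\<lambda>(k, z). gen_prod (replicate k 0) + (z::thompson_F))"
  have finY: "finite Y" by (simp add: Y_def finZ)
  have injy: "inj_on y Y" unfolding y_def Y_def Z_def by (rule inj_on_gen0_power_add)
  have "card T \<le> (\<Sum>i\<le>d. card (Z (n + i)))"
    unfolding T_def by (rule card_UN_le) simp
  also have "\<dots> \<le> (\<Sum>i\<le>d. card (Z (n + d)))"
    unfolding Z_def using r by (intro sum_mono card_sorted_prods_mono) auto
  also have "\<dots> = Suc d * card (Z (n + d))" by simp
  also have "\<dots> < card Y"
    using n by (simp add: Y_def N_def card_cartesian_product mult.assoc del: mult_Suc power_Suc)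
  finally have card: "card T < card Y" .
  have finT: "finite T" by (simp add: T_def finZ)
  let ?single = "Poly_Mapping.single :: thompson_F \<Rightarrow> 'k \<Rightarrow> _"
  let ?x = "1 - group_ring_elem (thompson_gen 0) :: (thompson_F, 'k) group_ring"
  \<comment> \<open>\<open>f (k, z)\<close> is the residue of \<open>b\<close> times the denominator
    times \<open>y (k, z)\<close>, with all leading powers of \<open>x_0\<close> dropped.\<close>
  define f where "f = (\<lambda>(k, z). \<Sum>g\<in>Poly_Mapping.keys b.
    ?single (gen_prod (map (\<lambda>i. i + k) (w g)) + z) (Poly_Mapping.lookup b g))"
  have span: "f p \<in> group_ring.span ((\<lambda>t. ?single t 1) ` T)" if p: "p \<in> Y" for p
  proof -
    obtain k z where kz: "p = (k, z)" "k < N" "z \<in> Z n" using p by (auto simp: Y_def)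
    have "?single (gen_prod (map (\<lambda>i. i + k) (w g)) + z) (Poly_Mapping.lookup b g)
        \<in> group_ring.span ((\<lambda>t. ?single t 1) ` T)" if g: "g \<in> Poly_Mapping.keys b" for g
    proof -
      have "0 < i" if "i \<in> set (w g)" for i using w(1)[OF g] that by (cases i) auto
      then have "set (map (\<lambda>i. i + k) (w g)) \<subseteq> {1..r}"
        using m[OF g] kz(2) by (fastforce simp: r_def)
      from gen_prod_add_sorted_prods[OF this, of z n]
      have "gen_prod (map (\<lambda>i. i + k) (w g)) + z \<in> T"
        using kz(3) d[OF g] by (auto simp: T_def Z_def add.commute)
      from group_ring.span_scale[OF group_ring.span_base[OF imageI[OF this]],
          of "\<lambda>t. ?single t 1" "Poly_Mapping.lookup b g"]
      show ?thesis by (simp add: mult_single)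
    qed
    then show ?thesis unfolding f_def kz by (auto intro: group_ring.span_sum)
  qed
  have "card ((\<lambda>t. ?single t 1) ` T) < card Y"
    using card card_image_le[OF finT, of "\<lambda>t. ?single t 1"] by linarith
  from group_ring.nontrivial_relation[OF finite_imageI[OF finT] this, of f] span
  obtain c p where c: "p \<in> Y" "c p \<noteq> 0" "(\<Sum>p\<in>Y. f p * ?single 0 (c p)) = 0"
    by blast
  define b' where "b' = b * ?single (gen_prod q) 1"
  have "\<exists>u. b' * ?single (y p) 1 = f p + ?x * u" if p: "p \<in> Y" for p
  proof -
    obtain k z where kz: "p = (k, z)" by (cases p)
    let ?h = "\<lambda>g. gen_prod (map (\<lambda>i. i + k) (w g)) + z"
    have "\<forall>g. \<exists>u. ?single (gen_prod (replicate (a g + k) 0) + ?h g) (Poly_Mapping.lookup b g)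
        = ?single (?h g) (Poly_Mapping.lookup b g) + ?x * u"
      using drop_gen0_power by blast
    then obtain u where u: "\<And>g. ?single (gen_prod (replicate (a g + k) 0) + ?h g) (Poly_Mapping.lookup b g)
        = ?single (?h g) (Poly_Mapping.lookup b g) + ?x * u g"
      by metis
    \<comment> \<open>Moving \<open>x_0^k\<close> left across \<open>w g\<close> raises every index
      by \<open>k\<close> and merges it with the leading power of \<open>x_0\<close>.\<close>
    have g: "g + gen_prod q + y p = gen_prod (replicate (a g + k) 0) + ?h g"
      if "g \<in> Poly_Mapping.keys b" for g
      using w[OF that]
      by (simp add: y_def kz gen_prod_add_replicate replicate_add add.assoc del: map_replicate)
    have "b' * ?single (y p) 1 = (\<Sum>g\<in>Poly_Mapping.keys b. ?single g (Poly_Mapping.lookup b g))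
        * ?single (gen_prod q + y p) 1"
      by (simp add: b'_def poly_mapping_eq_sum_single mult_single mult.assoc)
    also have "\<dots> = (\<Sum>g\<in>Poly_Mapping.keys b. ?single (g + gen_prod q + y p) (Poly_Mapping.lookup b g))"
      by (simp add: sum_distrib_right mult_single add.assoc)
    also have "\<dots> = (\<Sum>g\<in>Poly_Mapping.keys b. ?single (?h g) (Poly_Mapping.lookup b g) + ?x * u g)"
      by (intro sum.cong HOL.refl) (simp only: g u)
    also have "\<dots> = f p + ?x * (\<Sum>g\<in>Poly_Mapping.keys b. u g)"
      by (simp add: f_def kz sum.distrib sum_distrib_left)
    finally show ?thesis by blast
  qed
  then obtain u where u: "\<And>p. p \<in> Y \<Longrightarrow> b' * ?single (y p) 1 = f p + ?x * u p" by metis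
  define v where "v = (\<Sum>p\<in>Y. ?single (y p) (c p))"
  have "b' * v = (\<Sum>p\<in>Y. (b' * ?single (y p) 1) * ?single 0 (c p))"
    by (simp add: v_def sum_distrib_left mult.assoc mult_single)
  also have "\<dots> = (\<Sum>p\<in>Y. f p * ?single 0 (c p) + ?x * (u p * ?single 0 (c p)))"
    by (intro sum.cong HOL.refl) (simp add: u ring_distribs mult.assoc)
  also have "\<dots> = ?x * (\<Sum>p\<in>Y. u p * ?single 0 (c p))"
    by (simp add: sum.distrib c(3) flip: sum_distrib_left)
  finally have "?x * (\<Sum>p\<in>Y. u p * ?single 0 (c p)) = b * (?single (gen_prod q) 1 * v)"
    by (simp add: b'_def mult.assoc)
  moreover have "v \<noteq> 0"
    unfolding v_def using finY injy c(1,2) by (rule sum_single_nonzero)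
  \<comment> \<open>A group element is a unit of the group ring.\<close>
  then have "?single (gen_prod q) 1 * v \<noteq> 0"
  proof (rule contrapos_nn)
    assume "?single (gen_prod q) 1 * v = 0"
    then have "?single (- gen_prod q) 1 * (?single (gen_prod q) 1 * v) = 0" by simp
    then show "v = 0" by (simp add: mult_single flip: mult.assoc)
  qed
  ultimately show ?thesis by blast
qed

end
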